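(* As a $\mathbb{Q}_2$-algebra, $\mathcal{J}_2$ is generated by $Jq^1$ and $Jq^2$, that is, $$\mathcal{J}_2\otimes_{\mathbb{Z}_2}\mathbb{Q}_2=\mathbb{Q}_2\langle Jq^1,Jq^2\rangle,$$ where the right-hand side denotes the $\mathbb{Q}_2$-subalgebra generated by $Jq^1$ and $Jq^2$.
   Context: $\mathbb{Z}_2$ is the ring of dyadic ($2$-adic) integers and $\mathbb{Q}_2$ its fraction field. $\mathbb{Z}_2[\xi_1,\dots,\xi_n]$ is graded by $\deg\xi_i=1$. $Jq$ is the $\mathbb{Z}_2$-algebra endomorphism with $Jq(1)=1$, $Jq(\xi_i)=\xi_i+\xi_i^2$. For $k\ge0$, $Jq^k$ is the $\mathbb{Z}_2$-linear map raising degree by $k$ obtained, on each degree $d$, by restricting $Jq$ to degree $d$ and projecting onto degree $d+k$; $Jq^0=1$. The dyadic Steenrod algebra $\mathcal{J}_2$ is the (non-commutative) $\mathbb{Z}_2$-algebra generated under composition by the $Jq^k$, $k\ge0$, two elements being equal when they agree as operators on $\mathbb{Z}_2[\xi_1,\dots,\xi_n]$ for every $n$. *)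

theory Defs
  imports
    "HOL-Computational_Algebra.Fraction_Field"
    "HOL-Computational_Algebra.Primes"
    "HOL-Library.Poly_Mapping"
begin

section \<open>Dyadic integers\<close>

text \<open>
  The inverse limit of the rings $\mathbf{Z}/2^n$, each residue class being represented by its
  least nonnegative element.
\<close>

typedef dyadic = "{x :: nat \<Rightarrow> int. \<forall>n. 0 \<le> x n \<and> x n < 2 ^ n \<and> x (Suc n) mod 2 ^ n = x n}"
  by (rule exI[of _ "\<lambda>_. 0"]) auto

setup_lifting type_definition_dyadic

lemma dyadic_coherent:
  "(x mod 2 ^ Suc n) mod 2 ^ n = x mod (2 ^ n :: int)"
  by (simp add: mod_mod_cancel)

instantiation dyadic :: comm_ring_1
begin

lift_definition zero_dyadic :: dyadic is "\<lambda>_. 0" by simp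

lift_definition one_dyadic :: dyadic is "\<lambda>n. 1 mod 2 ^ n"
  by (metis dyadic_coherent pos_mod_bound pos_mod_sign zero_less_numeral zero_less_power)

lift_definition plus_dyadic :: "dyadic \<Rightarrow> dyadic \<Rightarrow> dyadic" is "\<lambda>x y n. (x n + y n) mod 2 ^ n"
  by (metis dyadic_coherent mod_add_eq pos_mod_bound pos_mod_sign zero_less_numeral zero_less_power)

lift_definition uminus_dyadic :: "dyadic \<Rightarrow> dyadic" is "\<lambda>x n. (- x n) mod 2 ^ n"
  by (metis dyadic_coherent mod_minus_eq pos_mod_bound pos_mod_sign zero_less_numeral zero_less_power)

lift_definition minus_dyadic :: "dyadic \<Rightarrow> dyadic \<Rightarrow> dyadic" is "\<lambda>x y n. (x n - y n) mod 2 ^ n"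
  by (metis dyadic_coherent mod_diff_eq pos_mod_bound pos_mod_sign zero_less_numeral zero_less_power)

lift_definition times_dyadic :: "dyadic \<Rightarrow> dyadic \<Rightarrow> dyadic" is "\<lambda>x y n. (x n * y n) mod 2 ^ n"
  by (metis dyadic_coherent mod_mult_eq pos_mod_bound pos_mod_sign zero_less_numeral zero_less_power)

instance
proof
  fix a b c :: dyadic
  show "a * b * c = a * (b * c)"
    by transfer (simp add: fun_eq_iff mod_mult_left_eq mod_mult_right_eq mult.assoc)
  show "a * b = b * a"
    by transfer (simp add: mult.commute)
  show "1 * a = a"
    by transfer (auto simp: fun_eq_iff mod_mult_left_eq simp del: one_mod_2_pow_eq)
  show "a + b + c = a + (b + c)"
    by transfer (simp add: fun_eq_iff mod_add_left_eq mod_add_right_eq add.assoc)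
  show "a + b = b + a"
    by transfer (simp add: add.commute)
  show "0 + a = a"
    by transfer (auto simp: fun_eq_iff)
  show "- a + a = 0"
    by transfer (auto simp: fun_eq_iff mod_add_left_eq)
  show "a - b = a + - b"
    by transfer (auto simp: fun_eq_iff mod_add_right_eq)
  show "(a + b) * c = a * c + b * c"
    by transfer (simp add: fun_eq_iff mod_add_left_eq mod_add_right_eq mod_mult_left_eq mod_add_eq distrib_right)
  show "(0::dyadic) \<noteq> 1"
    by transfer (auto simp: fun_eq_iff intro: exI[of _ 1])
qed

end

lemma dyadic_mod_power:
  assumes "\<forall>n. 0 \<le> x n \<and> x n < 2 ^ n \<and> x (Suc n) mod 2 ^ n = (x n :: int)"
  shows "x (n + k) mod 2 ^ n = x n"
proof (induction k)
  case 0
  then show ?case using assms by simp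
next
  case (Suc k)
  have "x (n + Suc k) mod 2 ^ n = (x (Suc (n + k)) mod 2 ^ (n + k)) mod 2 ^ n"
    by (simp add: mod_mod_cancel le_imp_power_dvd)
  also have "\<dots> = x (n + k) mod 2 ^ n" using assms by metis
  finally show ?case using Suc by simp
qed

lemma prime_power_dvd_prod_int:
  fixes a b :: int
  assumes "2 ^ (m + n) dvd a * b"
  shows "2 ^ m dvd a \<or> 2 ^ n dvd b"
  using assms
proof (induction m arbitrary: a)
  case 0
  then show ?case by simp
next
  case (Suc m)
  show ?case
  proof (cases "even a")
    case True
    then obtain c where "a = 2 * c" by blast
    then show ?thesis using Suc by (auto simp: mult.assoc)
  next
    case False
    then have "coprime (2 ^ (Suc m + n)) a" by simp
    then have "2 ^ (Suc m + n) dvd b" using Suc.prems by (simp add: coprime_dvd_mult_right_iff)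
    then show ?thesis by (meson dvd_trans le_add2 le_imp_power_dvd)
  qed
qed

instance dyadic :: idom
proof
  fix a b :: dyadic
  assume "a \<noteq> 0" "b \<noteq> 0"
  then show "a * b \<noteq> 0"
  proof (transfer, goal_cases)
    case (1 x y)
    have x: "\<forall>n. 0 \<le> x n \<and> x n < 2 ^ n \<and> x (Suc n) mod 2 ^ n = x n"
      and y: "\<forall>n. 0 \<le> y n \<and> y n < 2 ^ n \<and> y (Suc n) mod 2 ^ n = y n"
      using 1 by blast+
    from 1 obtain m n where m: "x m \<noteq> 0" and n: "y n \<noteq> 0" by (auto simp: fun_eq_iff)
    have "\<not> 2 ^ m dvd x (m + n)"
      using dyadic_mod_power[OF x, of m n] m by (simp add: dvd_eq_mod_eq_0)
    moreover have "\<not> 2 ^ n dvd y (m + n)"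
      using dyadic_mod_power[OF y, of n m] n by (simp add: dvd_eq_mod_eq_0 add.commute)
    ultimately have "\<not> 2 ^ (m + n) dvd x (m + n) * y (m + n)"
      using prime_power_dvd_prod_int by blast
    then show ?case by (metis dvd_eq_mod_eq_0)
  qed
qed

type_synonym dyadic_rational = "dyadic fract"

text \<open>
  The type \<^typ>\<open>dyadic_rational\<close> is the fraction field $\mathbf{Q}_2$ of the dyadic integers.
\<close>


section \<open>Algebras over the dyadic integers\<close>

class dyadic_algebra = ring_1 +
  fixes dscale :: "dyadic \<Rightarrow> 'a \<Rightarrow> 'a"  (infixr \<open>*\<^sub>D\<close> 75)
  assumes dscale_add_right: "r *\<^sub>D (a + b) = r *\<^sub>D a + r *\<^sub>D b"
    and dscale_add_left: "(r + s) *\<^sub>D a = r *\<^sub>D a + s *\<^sub>D a"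
    and dscale_dscale: "r *\<^sub>D (s *\<^sub>D a) = (r * s) *\<^sub>D a"
    and dscale_one: "1 *\<^sub>D a = a"
    and dscale_mult_left: "(r *\<^sub>D a) * b = r *\<^sub>D (a * b)"
    and dscale_mult_right: "a * (r *\<^sub>D b) = r *\<^sub>D (a * b)"

text \<open>
  The unital subalgebra generated by \<open>S\<close>, with respect to the scalar multiplication \<open>scale\<close>. Closure
  under zero and negation is the instance of closure under scalars for the scalars 0 and -1.
\<close>

inductive_set subalgebra_generated ::
    "('r \<Rightarrow> 'a \<Rightarrow> 'a) \<Rightarrow> 'a set \<Rightarrow> ('a :: {ring, monoid_mult}) set"
  for scale :: "'r \<Rightarrow> 'a \<Rightarrow> 'a" and S :: "'a set" where
  generator: "a \<in> S \<Longrightarrow> a \<in> subalgebra_generated scale S"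
| one: "1 \<in> subalgebra_generated scale S"
| add: "a \<in> subalgebra_generated scale S \<Longrightarrow> b \<in> subalgebra_generated scale S \<Longrightarrow>
    a + b \<in> subalgebra_generated scale S"
| mult: "a \<in> subalgebra_generated scale S \<Longrightarrow> b \<in> subalgebra_generated scale S \<Longrightarrow>
    a * b \<in> subalgebra_generated scale S"
| scale: "a \<in> subalgebra_generated scale S \<Longrightarrow> scale r a \<in> subalgebra_generated scale S"


section \<open>Polynomials and the operation Jq\<close>

text \<open>
  Polynomials are finitely supported functions from exponent vectors (themselves finitely supported)
  to coefficients. All the rings $\mathbf{Z}_2[\xi_1,\dots,\xi_n]$ live inside this one type;
  \<open>poly_ring n\<close> is the set of polynomials involving only the variables with index in
  \<open>{1..n}\<close>.
\<close>

type_synonym dpoly = "(nat \<Rightarrow>\<^sub>0 nat) \<Rightarrow>\<^sub>0 dyadic"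

definition poly_ring :: "nat \<Rightarrow> dpoly set" where
  "poly_ring n = {p. \<forall>m\<in>Poly_Mapping.keys p. Poly_Mapping.keys m \<subseteq> {1..n}}"

definition const :: "dyadic \<Rightarrow> dpoly" where
  "const c = Poly_Mapping.single 0 c"

definition xi :: "nat \<Rightarrow> dpoly" where
  "xi i = Poly_Mapping.single (Poly_Mapping.single i 1) 1"

definition mdeg :: "(nat \<Rightarrow>\<^sub>0 nat) \<Rightarrow> nat" where
  "mdeg m = (\<Sum>i\<in>Poly_Mapping.keys m. Poly_Mapping.lookup m i)"

definition homogeneous_part :: "nat \<Rightarrow> dpoly \<Rightarrow> dpoly" where
  "homogeneous_part d p = (\<Sum>m\<in>{m\<in>Poly_Mapping.keys p. mdeg m = d}. Poly_Mapping.single m (Poly_Mapping.lookup p m))"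

text \<open>
  \<open>Jq_total\<close> is substitution of \<open>xi i + (xi i)\<^sup>2\<close> for every \<open>xi i\<close>; the lemmas
  \<open>Jq_total_add\<close>, \<open>Jq_total_mult\<close>, \<open>Jq_total_const\<close> and \<open>Jq_total_xi\<close> below say that it is
  the algebra endomorphism with the prescribed values on the variables.
\<close>

definition Jq_monomial :: "(nat \<Rightarrow>\<^sub>0 nat) \<Rightarrow> dpoly" where
  "Jq_monomial m = (\<Prod>i\<in>Poly_Mapping.keys m. (xi i + xi i ^ 2) ^ Poly_Mapping.lookup m i)"

definition Jq_total :: "dpoly \<Rightarrow> dpoly" where
  "Jq_total p = (\<Sum>m\<in>Poly_Mapping.keys p. const (Poly_Mapping.lookup p m) * Jq_monomial m)"

text \<open>
  The component of \<^const>\<open>Jq_total\<close> raising the degree by \<open>k\<close>. The sum runs over all the degrees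
  in which \<open>p\<close> has a nonzero homogeneous part.
\<close>

definition Jq_op :: "nat \<Rightarrow> dpoly \<Rightarrow> dpoly" where
  "Jq_op k p = (\<Sum>d\<in>mdeg ` Poly_Mapping.keys p. homogeneous_part (d + k) (Jq_total (homogeneous_part d p)))"

lemma keys_sum_subset: "Poly_Mapping.keys (sum f A) \<subseteq> (\<Union>a\<in>A. Poly_Mapping.keys (f a :: 'a \<Rightarrow>\<^sub>0 'b :: comm_monoid_add))"
proof (induction A rule: infinite_finite_induct)
  case (insert x F)
  then show ?case using keys_add[of "f x" "sum f F"] by auto
qed auto

lemma poly_decompose: "p = (\<Sum>m\<in>Poly_Mapping.keys p. Poly_Mapping.single m (Poly_Mapping.lookup p m))"
  by (rule poly_mapping_eqI)
     (simp add: lookup_sum lookup_single when_def in_keys_iff)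

lemma lookup_homogeneous_part:
  "Poly_Mapping.lookup (homogeneous_part d p) m = (if mdeg m = d then Poly_Mapping.lookup p m else 0)"
  by (simp add: homogeneous_part_def lookup_sum lookup_single when_def in_keys_iff)

lemma keys_homogeneous_part: "Poly_Mapping.keys (homogeneous_part d p) = {m\<in>Poly_Mapping.keys p. mdeg m = d}"
  by (auto simp: in_keys_iff lookup_homogeneous_part split: if_splits)

lemma homogeneous_part_add:
  "homogeneous_part d (p + q) = homogeneous_part d p + homogeneous_part d q"
  by (rule poly_mapping_eqI) (simp add: lookup_homogeneous_part lookup_add)

lemma lookup_const_mult: "Poly_Mapping.lookup (const c * p) m = c * Poly_Mapping.lookup p m"
  unfolding const_def mult_map_scale_conv_mult[symmetric]
  by (simp add: Poly_Mapping.map.rep_eq when_def)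

lemma homogeneous_part_const_mult:
  "homogeneous_part d (const c * p) = const c * homogeneous_part d p"
  by (rule poly_mapping_eqI) (simp add: lookup_homogeneous_part lookup_const_mult)

lemma const_0: "const 0 = 0"
  and const_1: "const 1 = 1"
  and const_add: "const (a + b) = const a + const b"
  and const_mult: "const (a * b) = const a * const b"
  by (simp_all add: const_def single_add mult_single)

lemma homogeneous_part_absent: "d \<notin> mdeg ` Poly_Mapping.keys p \<Longrightarrow> homogeneous_part d p = 0"
  by (rule poly_mapping_eqI) (auto simp: lookup_homogeneous_part in_keys_iff image_iff)

lemma Jq_total_superset:
  assumes "finite A" "Poly_Mapping.keys p \<subseteq> A"
  shows "Jq_total p = (\<Sum>m\<in>A. const (Poly_Mapping.lookup p m) * Jq_monomial m)"
  unfolding Jq_total_def using assms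
  by (intro sum.mono_neutral_left) (auto simp: in_keys_iff const_0)

lemma Jq_total_add: "Jq_total (p + q) = Jq_total p + Jq_total q"
proof -
  let ?A = "Poly_Mapping.keys p \<union> Poly_Mapping.keys q"
  have "Poly_Mapping.keys (p + q) \<subseteq> ?A" by (rule keys_add)
  then show ?thesis
    by (simp add: Jq_total_superset[of ?A] lookup_add const_add distrib_right sum.distrib)
qed

lemma Jq_total_0: "Jq_total 0 = 0"
  by (simp add: Jq_total_def)

lemma Jq_total_sum: "Jq_total (sum f A) = (\<Sum>a\<in>A. Jq_total (f a))"
  by (induction A rule: infinite_finite_induct) (simp_all add: Jq_total_0 Jq_total_add)

lemma Jq_total_const_mult: "Jq_total (const c * p) = const c * Jq_total p"
proof -
  have "Poly_Mapping.keys (const c * p) \<subseteq> Poly_Mapping.keys p" by (auto simp: in_keys_iff lookup_const_mult)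
  then show ?thesis
    by (simp add: Jq_total_superset[of "Poly_Mapping.keys p"] lookup_const_mult const_mult sum_distrib_left mult.assoc)
qed

lemma Jq_total_single: "Jq_total (Poly_Mapping.single m c) = const c * Jq_monomial m"
  by (simp add: Jq_total_def const_0)

lemma Jq_monomial_superset:
  assumes "finite A" "Poly_Mapping.keys m \<subseteq> A"
  shows "Jq_monomial m = (\<Prod>i\<in>A. (xi i + xi i ^ 2) ^ Poly_Mapping.lookup m i)"
  unfolding Jq_monomial_def using assms
  by (intro prod.mono_neutral_left) (auto simp: in_keys_iff)

lemma Jq_monomial_add: "Jq_monomial (m + n) = Jq_monomial m * Jq_monomial n"
proof -
  let ?A = "Poly_Mapping.keys m \<union> Poly_Mapping.keys n"
  have "Poly_Mapping.keys (m + n) \<subseteq> ?A" by (rule keys_add)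
  then show ?thesis
    by (simp add: Jq_monomial_superset[of ?A] lookup_add power_add prod.distrib)
qed

lemma Jq_total_mult: "Jq_total (p * q) = Jq_total p * Jq_total q"
proof -
  have "p * q = (\<Sum>m\<in>Poly_Mapping.keys p. \<Sum>n\<in>Poly_Mapping.keys q.
      Poly_Mapping.single (m + n) (Poly_Mapping.lookup p m * Poly_Mapping.lookup q n))"
    by (subst poly_decompose[of p], subst poly_decompose[of q])
       (simp add: sum_product mult_single)
  then have "Jq_total (p * q) = (\<Sum>m\<in>Poly_Mapping.keys p. \<Sum>n\<in>Poly_Mapping.keys q.
      (const (Poly_Mapping.lookup p m) * Jq_monomial m) * (const (Poly_Mapping.lookup q n) * Jq_monomial n))"
    by (simp add: Jq_total_sum Jq_total_single Jq_monomial_add const_mult mult_ac)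
  then show ?thesis by (simp add: Jq_total_def sum_product)
qed

lemma Jq_total_const: "Jq_total (const c) = const c"
  using Jq_total_single[of 0 c] by (simp add: const_def Jq_monomial_def)

lemma Jq_total_xi: "Jq_total (xi i) = xi i + xi i ^ 2"
  unfolding xi_def by (subst Jq_total_single) (simp add: const_1 Jq_monomial_def xi_def)

lemma Jq_op_superset:
  assumes "finite D" "mdeg ` Poly_Mapping.keys p \<subseteq> D"
  shows "Jq_op k p = (\<Sum>d\<in>D. homogeneous_part (d + k) (Jq_total (homogeneous_part d p)))"
  unfolding Jq_op_def using assms
  by (intro sum.mono_neutral_left)
     (auto simp: homogeneous_part_absent Jq_total_0)

lemma Jq_op_add: "Jq_op k (p + q) = Jq_op k p + Jq_op k q"
proof -
  let ?D = "mdeg ` (Poly_Mapping.keys p \<union> Poly_Mapping.keys q)"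
  have "mdeg ` Poly_Mapping.keys (p + q) \<subseteq> ?D" using keys_add[of p q] by auto
  then show ?thesis
    by (subst (1 2 3) Jq_op_superset[of ?D])
       (auto simp: homogeneous_part_add Jq_total_add sum.distrib)
qed

lemma Jq_op_const_mult: "Jq_op k (const c * p) = const c * Jq_op k p"
proof -
  have "mdeg ` Poly_Mapping.keys (const c * p) \<subseteq> mdeg ` Poly_Mapping.keys p"
    by (auto simp: in_keys_iff lookup_const_mult)
  then show ?thesis
    by (subst (1 2) Jq_op_superset[of "mdeg ` Poly_Mapping.keys p"])
       (auto simp: homogeneous_part_const_mult Jq_total_const_mult sum_distrib_left)
qed

lemma poly_ring_0: "0 \<in> poly_ring n"
  and poly_ring_1: "1 \<in> poly_ring n"
  and poly_ring_const: "const c \<in> poly_ring n"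
  and poly_ring_xi: "i \<in> {1..n} \<Longrightarrow> xi i \<in> poly_ring n"
  by (auto simp: poly_ring_def const_def xi_def)

lemma poly_ring_add: "p \<in> poly_ring n \<Longrightarrow> q \<in> poly_ring n \<Longrightarrow> p + q \<in> poly_ring n"
  using keys_add[of p q] by (auto simp: poly_ring_def)

lemma poly_ring_uminus: "p \<in> poly_ring n \<Longrightarrow> - p \<in> poly_ring n"
  by (auto simp: poly_ring_def in_keys_iff)

lemma poly_ring_diff: "p \<in> poly_ring n \<Longrightarrow> q \<in> poly_ring n \<Longrightarrow> p - q \<in> poly_ring n"
  using poly_ring_add[of p n "- q"] poly_ring_uminus[of q n] by simp

lemma poly_ring_sum: "(\<And>a. a \<in> A \<Longrightarrow> f a \<in> poly_ring n) \<Longrightarrow> sum f A \<in> poly_ring n"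
  by (induction A rule: infinite_finite_induct) (auto simp: poly_ring_0 poly_ring_add)

lemma poly_ring_mult:
  assumes "p \<in> poly_ring n" "q \<in> poly_ring n"
  shows "p * q \<in> poly_ring n"
  unfolding poly_ring_def
proof safe
  fix m i assume "m \<in> Poly_Mapping.keys (p * q)" and i: "i \<in> Poly_Mapping.keys m"
  then obtain a b where ab: "a \<in> Poly_Mapping.keys p" "b \<in> Poly_Mapping.keys q" "m = a + b"
    using keys_mult[of p q] by auto
  then have "i \<in> Poly_Mapping.keys a \<union> Poly_Mapping.keys b" using i keys_add[of a b] by auto
  then show "i \<in> {1..n}" using ab assms by (fastforce simp: poly_ring_def)
qed

lemma poly_ring_power: "p \<in> poly_ring n \<Longrightarrow> p ^ k \<in> poly_ring n"
  by (induction k) (auto simp: poly_ring_1 poly_ring_mult)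

lemma poly_ring_prod: "(\<And>a. a \<in> A \<Longrightarrow> f a \<in> poly_ring n) \<Longrightarrow> prod f A \<in> poly_ring n"
  by (induction A rule: infinite_finite_induct) (auto simp: poly_ring_1 poly_ring_mult)

lemma poly_ring_homogeneous_part: "p \<in> poly_ring n \<Longrightarrow> homogeneous_part d p \<in> poly_ring n"
  by (auto simp: poly_ring_def keys_homogeneous_part)

lemma poly_ring_Jq_total:
  assumes "p \<in> poly_ring n"
  shows "Jq_total p \<in> poly_ring n"
  unfolding Jq_total_def Jq_monomial_def using assms
  by (intro poly_ring_sum poly_ring_mult poly_ring_const poly_ring_prod poly_ring_power
        poly_ring_add poly_ring_xi) (auto simp: poly_ring_def dest!: bspec subsetD)

lemma poly_ring_Jq_op: "p \<in> poly_ring n \<Longrightarrow> Jq_op k p \<in> poly_ring n"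
  unfolding Jq_op_def
  by (intro poly_ring_sum poly_ring_homogeneous_part poly_ring_Jq_total)


section \<open>The dyadic Steenrod algebra\<close>

text \<open>
  An element of \<open>poly_ops\<close> is a family consisting of one $\mathbf{Z}_2$-linear endomorphism of
  $\mathbf{Z}_2[\xi_1,\dots,\xi_n]$ for every \<open>n\<close>. Operators are total functions on
  \<^typ>\<open>dpoly\<close>, normalised to vanish outside \<open>poly_ring n\<close>, so that equality of families is
  agreement on $\mathbf{Z}_2[\xi_1,\dots,\xi_n]$ for every \<open>n\<close> (lemma \<open>poly_ops_eqI\<close>).
\<close>

typedef poly_ops = "{F :: nat \<Rightarrow> dpoly \<Rightarrow> dpoly. \<forall>n.
    (\<forall>p\<in>poly_ring n. F n p \<in> poly_ring n) \<and>
    (\<forall>p\<in>poly_ring n. \<forall>q\<in>poly_ring n. F n (p + q) = F n p + F n q) \<and>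
    (\<forall>c. \<forall>p\<in>poly_ring n. F n (const c * p) = const c * F n p) \<and>
    (\<forall>p. p \<notin> poly_ring n \<longrightarrow> F n p = 0)}"
  morphisms apply_op Abs_poly_ops
  by (rule exI[of _ "\<lambda>_ _. 0"]) (auto simp: poly_ring_0)

setup_lifting type_definition_poly_ops

lemma apply_op_closed: "p \<in> poly_ring n \<Longrightarrow> apply_op F n p \<in> poly_ring n"
  and apply_op_add: "p \<in> poly_ring n \<Longrightarrow> q \<in> poly_ring n \<Longrightarrow>
    apply_op F n (p + q) = apply_op F n p + apply_op F n q"
  and apply_op_const_mult: "p \<in> poly_ring n \<Longrightarrow>
    apply_op F n (const c * p) = const c * apply_op F n p"
  and apply_op_outside: "p \<notin> poly_ring n \<Longrightarrow> apply_op F n p = 0"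
  using apply_op[of F] by auto

lemma poly_ops_eqI:
  assumes "\<And>n p. p \<in> poly_ring n \<Longrightarrow> apply_op F n p = apply_op G n p"
  shows "F = G"
  by (metis assms apply_op_outside apply_op_inject ext)

instantiation poly_ops :: dyadic_algebra
begin

lift_definition zero_poly_ops :: poly_ops is "\<lambda>_ _. 0"
  by (auto simp: poly_ring_0)

lift_definition one_poly_ops :: poly_ops is "\<lambda>n p. if p \<in> poly_ring n then p else 0"
  by (auto simp: poly_ring_add poly_ring_mult poly_ring_const)

lift_definition plus_poly_ops :: "poly_ops \<Rightarrow> poly_ops \<Rightarrow> poly_ops" is "\<lambda>F G n p. F n p + G n p"
  by (auto simp: poly_ring_add distrib_left)

lift_definition uminus_poly_ops :: "poly_ops \<Rightarrow> poly_ops" is "\<lambda>F n p. - F n p"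
  by (auto simp: poly_ring_uminus)

lift_definition minus_poly_ops :: "poly_ops \<Rightarrow> poly_ops \<Rightarrow> poly_ops" is "\<lambda>F G n p. F n p - G n p"
  by (auto simp: poly_ring_diff right_diff_distrib)

lift_definition times_poly_ops :: "poly_ops \<Rightarrow> poly_ops \<Rightarrow> poly_ops" is
  "\<lambda>F G n p. if p \<in> poly_ring n then F n (G n p) else 0"
  by (auto simp: poly_ring_add poly_ring_mult poly_ring_const)

lift_definition dscale_poly_ops :: "dyadic \<Rightarrow> poly_ops \<Rightarrow> poly_ops" is "\<lambda>c F n p. const c * F n p"
  by (auto simp: poly_ring_mult poly_ring_const distrib_left mult_ac)

lemmas apply_op_simps =
  zero_poly_ops.rep_eq one_poly_ops.rep_eq plus_poly_ops.rep_eq uminus_poly_ops.rep_eq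
  minus_poly_ops.rep_eq times_poly_ops.rep_eq dscale_poly_ops.rep_eq

instance
proof
  fix a b c :: poly_ops and r s :: dyadic
  show "a * b * c = a * (b * c)"
    by (rule poly_ops_eqI) (simp add: apply_op_simps apply_op_closed)
  show "1 * a = a"
    by (rule poly_ops_eqI) (simp add: apply_op_simps apply_op_closed)
  show "a * 1 = a"
    by (rule poly_ops_eqI) (simp add: apply_op_simps)
  show "a + b + c = a + (b + c)"
    by (rule poly_ops_eqI) (simp add: apply_op_simps)
  show "a + b = b + a"
    by (rule poly_ops_eqI) (simp add: apply_op_simps)
  show "0 + a = a"
    by (rule poly_ops_eqI) (simp add: apply_op_simps)
  show "- a + a = 0"
    by (rule poly_ops_eqI) (simp add: apply_op_simps)
  show "a - b = a + - b"
    by (rule poly_ops_eqI) (simp add: apply_op_simps)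
  show "(a + b) * c = a * c + b * c"
    by (rule poly_ops_eqI) (simp add: apply_op_simps)
  show "a * (b + c) = a * b + a * c"
    by (rule poly_ops_eqI) (simp add: apply_op_simps apply_op_closed apply_op_add)
  have "apply_op 0 0 1 \<noteq> apply_op 1 0 1"
    by (simp add: apply_op_simps poly_ring_1)
  then show "(0::poly_ops) \<noteq> 1"
    by auto
  show "r *\<^sub>D (a + b) = r *\<^sub>D a + r *\<^sub>D b"
    by (rule poly_ops_eqI) (simp add: apply_op_simps distrib_left)
  show "(r + s) *\<^sub>D a = r *\<^sub>D a + s *\<^sub>D a"
    by (rule poly_ops_eqI) (simp add: apply_op_simps const_add distrib_right)
  show "r *\<^sub>D s *\<^sub>D a = (r * s) *\<^sub>D a"
    by (rule poly_ops_eqI) (simp add: apply_op_simps const_mult mult.assoc)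
  show "1 *\<^sub>D a = a"
    by (rule poly_ops_eqI) (simp add: apply_op_simps const_1)
  show "(r *\<^sub>D a) * b = r *\<^sub>D (a * b)"
    by (rule poly_ops_eqI) (simp add: apply_op_simps)
  show "a * (r *\<^sub>D b) = r *\<^sub>D (a * b)"
    by (rule poly_ops_eqI) (simp add: apply_op_simps apply_op_closed apply_op_const_mult)
qed

end

lift_definition Jq_ops :: "nat \<Rightarrow> poly_ops" is
  "\<lambda>k n p. if p \<in> poly_ring n then Jq_op k p else 0"
  by (auto simp: poly_ring_Jq_op poly_ring_add poly_ring_mult poly_ring_const
        Jq_op_add Jq_op_const_mult)

typedef dyadic_steenrod = "subalgebra_generated (*\<^sub>D) (range Jq_ops)"
  morphisms steenrod_ops Abs_dyadic_steenrod
  using subalgebra_generated.one by blast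

setup_lifting type_definition_dyadic_steenrod

lemma dscale_zero_left: "0 *\<^sub>D a = (0 :: 'a :: dyadic_algebra)"
  using dscale_add_left[of 0 0 a] by simp

lemma dscale_minus_one: "(- 1) *\<^sub>D a = - (a :: 'a :: dyadic_algebra)"
  using dscale_add_left[of "- 1" 1 a]
  by (simp add: dscale_one dscale_zero_left eq_neg_iff_add_eq_0)

lemma subalgebra_generated_zero: "0 \<in> subalgebra_generated (*\<^sub>D) (S :: 'a :: dyadic_algebra set)"
  by (metis dscale_zero_left subalgebra_generated.one subalgebra_generated.scale)

lemma subalgebra_generated_uminus:
  "a \<in> subalgebra_generated (*\<^sub>D) S \<Longrightarrow> - a \<in> subalgebra_generated (*\<^sub>D) (S :: 'a :: dyadic_algebra set)"
  by (metis dscale_minus_one subalgebra_generated.scale)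

lemma subalgebra_generated_diff:
  "a \<in> subalgebra_generated (*\<^sub>D) S \<Longrightarrow> b \<in> subalgebra_generated (*\<^sub>D) S \<Longrightarrow>
    a - b \<in> subalgebra_generated (*\<^sub>D) (S :: 'a :: dyadic_algebra set)"
  using subalgebra_generated.add[of a "(*\<^sub>D)" S "- b"] subalgebra_generated_uminus[of b S] by simp

instantiation dyadic_steenrod :: dyadic_algebra
begin

lift_definition zero_dyadic_steenrod :: dyadic_steenrod is 0
  by (rule subalgebra_generated_zero)

lift_definition one_dyadic_steenrod :: dyadic_steenrod is 1
  by (rule subalgebra_generated.one)

lift_definition plus_dyadic_steenrod ::
  "dyadic_steenrod \<Rightarrow> dyadic_steenrod \<Rightarrow> dyadic_steenrod" is "(+)"
  by (rule subalgebra_generated.add)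

lift_definition uminus_dyadic_steenrod :: "dyadic_steenrod \<Rightarrow> dyadic_steenrod" is uminus
  by (rule subalgebra_generated_uminus)

lift_definition minus_dyadic_steenrod ::
  "dyadic_steenrod \<Rightarrow> dyadic_steenrod \<Rightarrow> dyadic_steenrod" is "(-)"
  by (rule subalgebra_generated_diff)

lift_definition times_dyadic_steenrod ::
  "dyadic_steenrod \<Rightarrow> dyadic_steenrod \<Rightarrow> dyadic_steenrod" is "(*)"
  by (rule subalgebra_generated.mult)

lift_definition dscale_dyadic_steenrod ::
  "dyadic \<Rightarrow> dyadic_steenrod \<Rightarrow> dyadic_steenrod" is "(*\<^sub>D)"
  by (rule subalgebra_generated.scale)

instance
  by standard
     (transfer; simp add: algebra_simps dscale_add_right dscale_add_left dscale_dscale dscale_one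
        dscale_mult_left dscale_mult_right)+

end

lift_definition Jq :: "nat \<Rightarrow> dyadic_steenrod" is Jq_ops
  by (rule subalgebra_generated.generator) simp


section \<open>Extension of scalars\<close>

lifting_forget dyadic.lifting
lifting_forget fract.lifting

text \<open>
  The tensor product of a $\mathbf{Z}_2$-algebra with $\mathbf{Q}_2$ over $\mathbf{Z}_2$: the free
  abelian group on pairs modulo the subgroup generated by the relators expressing biadditivity and
  balancedness. For a torsion algebra this can be the zero ring, so that in general only the sort
  \<open>{ring, monoid_mult}\<close> is available, not \<^class>\<open>ring_1\<close>.
\<close>

inductive_set tensor_null :: "(('a :: dyadic_algebra \<times> dyadic_rational) \<Rightarrow>\<^sub>0 int) set" where
  add_left: "frag_of (a + b, q) - frag_of (a, q) - frag_of (b, q) \<in> tensor_null"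
| add_right: "frag_of (a, p + q) - frag_of (a, p) - frag_of (a, q) \<in> tensor_null"
| balanced: "frag_of (r *\<^sub>D a, q) - frag_of (a, Fract r 1 * q) \<in> tensor_null"
| zero: "0 \<in> tensor_null"
| diff: "x \<in> tensor_null \<Longrightarrow> y \<in> tensor_null \<Longrightarrow> x - y \<in> tensor_null"

lemma tensor_null_uminus: "x \<in> tensor_null \<Longrightarrow> - x \<in> tensor_null"
  using tensor_null.diff[OF tensor_null.zero, of x] by simp

lemma tensor_null_add: "x \<in> tensor_null \<Longrightarrow> y \<in> tensor_null \<Longrightarrow> x + y \<in> tensor_null"
  using tensor_null.diff[of x "- y"] tensor_null_uminus[of y] by simp

quotient_type (overloaded) 'a tensor_Q2 =
  "('a :: dyadic_algebra \<times> dyadic_rational) \<Rightarrow>\<^sub>0 int" / "\<lambda>x y. x - y \<in> tensor_null"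
proof (rule equivpI)
  show "reflp (\<lambda>x y :: ('a \<times> dyadic_rational) \<Rightarrow>\<^sub>0 int. x - y \<in> tensor_null)"
    by (simp add: reflp_def tensor_null.zero)
  show "symp (\<lambda>x y :: ('a \<times> dyadic_rational) \<Rightarrow>\<^sub>0 int. x - y \<in> tensor_null)"
  proof (rule sympI)
    fix x y :: "('a \<times> dyadic_rational) \<Rightarrow>\<^sub>0 int"
    assume "x - y \<in> tensor_null"
    then have "- (x - y) \<in> tensor_null" by (rule tensor_null_uminus)
    then show "y - x \<in> tensor_null" by simp
  qed
  show "transp (\<lambda>x y :: ('a \<times> dyadic_rational) \<Rightarrow>\<^sub>0 int. x - y \<in> tensor_null)"
  proof (rule transpI)
    fix x y z :: "('a \<times> dyadic_rational) \<Rightarrow>\<^sub>0 int"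
    assume "x - y \<in> tensor_null" "y - z \<in> tensor_null"
    then have "(x - y) + (y - z) \<in> tensor_null" by (rule tensor_null_add)
    then show "x - z \<in> tensor_null" by simp
  qed
qed

definition frag_mult ::
  "(('a :: dyadic_algebra \<times> dyadic_rational) \<Rightarrow>\<^sub>0 int) \<Rightarrow> ('a \<times> dyadic_rational \<Rightarrow>\<^sub>0 int) \<Rightarrow>
    ('a \<times> dyadic_rational \<Rightarrow>\<^sub>0 int)" where
  "frag_mult x y = frag_extend (\<lambda>(a, p). frag_extend (\<lambda>(b, q). frag_of (a * b, p * q)) y) x"

definition frag_scale ::
  "dyadic_rational \<Rightarrow> (('a :: dyadic_algebra \<times> dyadic_rational) \<Rightarrow>\<^sub>0 int) \<Rightarrow>
    ('a \<times> dyadic_rational \<Rightarrow>\<^sub>0 int)" where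
  "frag_scale r x = frag_extend (\<lambda>(a, p). frag_of (a, r * p)) x"

lemma frag_induct [case_names zero one diff]:
  assumes "P 0" "\<And>a. P (frag_of a)" "\<And>a b. P a \<Longrightarrow> P b \<Longrightarrow> P (a - b)"
  shows "P (c :: 'a \<Rightarrow>\<^sub>0 int)"
  by (rule frag_induction[of c UNIV]) (use assms in auto)

lemma frag_mult_of: "frag_mult (frag_of (a, p)) (frag_of (b, q)) = frag_of (a * b, p * q)"
  by (simp add: frag_mult_def)

lemma frag_mult_0_left: "frag_mult 0 y = 0"
  and frag_mult_diff_left: "frag_mult (x - x') y = frag_mult x y - frag_mult x' y"
  and frag_mult_add_left: "frag_mult (x + x') y = frag_mult x y + frag_mult x' y"
  by (simp_all add: frag_mult_def frag_extend_diff frag_extend_add)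

lemma frag_mult_0_right: "frag_mult x 0 = 0"
  by (induction x rule: frag_induct)
     (auto simp: frag_mult_0_left frag_mult_diff_left, simp add: frag_mult_def)

lemma frag_mult_diff_right: "frag_mult x (y - y') = frag_mult x y - frag_mult x y'"
proof (induction x rule: frag_induct)
  case (one a)
  then show ?case by (cases a) (simp add: frag_mult_def frag_extend_diff)
qed (auto simp: frag_mult_0_left frag_mult_diff_left)

lemma frag_mult_add_right: "frag_mult x (y + y') = frag_mult x y + frag_mult x y'"
  using frag_mult_diff_right[of x y "0 - y'"] frag_mult_diff_right[of x 0 y']
  by (simp add: frag_mult_0_right)

lemma frag_mult_assoc: "frag_mult (frag_mult x y) z = frag_mult x (frag_mult y z)"
proof (induction x rule: frag_induct)
  case (one a)
  show ?case
  proof (induction y rule: frag_induct)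
    case (one b)
    show ?case
    proof (induction z rule: frag_induct)
      case (one c)
      show ?case
        by (cases a; cases b; cases c) (simp add: frag_mult_of mult.assoc)
    qed (auto simp: frag_mult_0_right frag_mult_diff_right)
  qed (auto simp: frag_mult_0_right frag_mult_diff_right frag_mult_0_left frag_mult_diff_left)
qed (auto simp: frag_mult_0_left frag_mult_diff_left)

lemma frag_mult_one_left: "frag_mult (frag_of (1, 1)) x = x"
proof (induction x rule: frag_induct)
  case (one a)
  then show ?case by (cases a) (simp add: frag_mult_of)
qed (auto simp: frag_mult_0_right frag_mult_diff_right)

lemma frag_mult_one_right: "frag_mult x (frag_of (1, 1)) = x"
proof (induction x rule: frag_induct)
  case (one a)
  then show ?case by (cases a) (simp add: frag_mult_of)
qed (auto simp: frag_mult_0_left frag_mult_diff_left)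

lemma frag_mult_null_left: "x \<in> tensor_null \<Longrightarrow> frag_mult x y \<in> tensor_null"
proof (induction y rule: frag_induct)
  case (one c)
  obtain e s where c: "c = (e, s)" by (cases c)
  from one show ?case
  proof (induction x rule: tensor_null.induct)
    case (add_left a b q)
    show ?case
      using tensor_null.add_left[of "a * e" "b * e" "q * s"]
      by (simp add: c frag_mult_diff_left frag_mult_of distrib_right)
  next
    case (add_right a p q)
    show ?case
      using tensor_null.add_right[of "a * e" "p * s" "q * s"]
      by (simp add: c frag_mult_diff_left frag_mult_of distrib_right)
  next
    case (balanced r a q)
    show ?case
      using tensor_null.balanced[of r "a * e" "q * s"]
      by (simp add: c frag_mult_diff_left frag_mult_of dscale_mult_left mult.assoc)
  qed (auto simp: frag_mult_0_left frag_mult_diff_left intro: tensor_null.zero tensor_null.diff)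
qed (auto simp: frag_mult_0_right frag_mult_diff_right intro: tensor_null.zero tensor_null.diff)

lemma frag_mult_null_right: "y \<in> tensor_null \<Longrightarrow> frag_mult x y \<in> tensor_null"
proof (induction x rule: frag_induct)
  case (one c)
  obtain e s where c: "c = (e, s)" by (cases c)
  from one show ?case
  proof (induction y rule: tensor_null.induct)
    case (add_left a b q)
    show ?case
      using tensor_null.add_left[of "e * a" "e * b" "s * q"]
      by (simp add: c frag_mult_diff_right frag_mult_of distrib_left)
  next
    case (add_right a p q)
    show ?case
      using tensor_null.add_right[of "e * a" "s * p" "s * q"]
      by (simp add: c frag_mult_diff_right frag_mult_of distrib_left)
  next
    case (balanced r a q)
    show ?case
      using tensor_null.balanced[of r "e * a" "s * q"]
      by (simp add: c frag_mult_diff_right frag_mult_of dscale_mult_right mult.left_commute)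
  qed (auto simp: frag_mult_0_right frag_mult_diff_right intro: tensor_null.zero tensor_null.diff)
qed (auto simp: frag_mult_0_left frag_mult_diff_left intro: tensor_null.zero tensor_null.diff)

lemma frag_scale_eq_mult: "frag_scale r x = frag_mult (frag_of (1, r)) x"
  by (simp add: frag_scale_def frag_mult_def)

instantiation tensor_Q2 :: (dyadic_algebra) "{ring, monoid_mult}"
begin

lift_definition zero_tensor_Q2 :: "'a tensor_Q2" is 0 .

lift_definition one_tensor_Q2 :: "'a tensor_Q2" is "frag_of (1, 1)" .

lift_definition plus_tensor_Q2 :: "'a tensor_Q2 \<Rightarrow> 'a tensor_Q2 \<Rightarrow> 'a tensor_Q2" is "(+)"
proof -
  fix x x' y y' :: "('a \<times> dyadic_rational) \<Rightarrow>\<^sub>0 int"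
  assume "x - x' \<in> tensor_null" "y - y' \<in> tensor_null"
  then have "(x - x') + (y - y') \<in> tensor_null" by (rule tensor_null_add)
  then show "(x + y) - (x' + y') \<in> tensor_null" by (simp add: algebra_simps)
qed

lift_definition uminus_tensor_Q2 :: "'a tensor_Q2 \<Rightarrow> 'a tensor_Q2" is uminus
proof -
  fix x x' :: "('a \<times> dyadic_rational) \<Rightarrow>\<^sub>0 int"
  assume "x - x' \<in> tensor_null"
  then have "- (x - x') \<in> tensor_null" by (rule tensor_null_uminus)
  then show "- x - - x' \<in> tensor_null" by (simp add: algebra_simps)
qed

lift_definition minus_tensor_Q2 :: "'a tensor_Q2 \<Rightarrow> 'a tensor_Q2 \<Rightarrow> 'a tensor_Q2" is "(-)"
proof -
  fix x x' y y' :: "('a \<times> dyadic_rational) \<Rightarrow>\<^sub>0 int"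
  assume "x - x' \<in> tensor_null" "y - y' \<in> tensor_null"
  then have "(x - x') - (y - y') \<in> tensor_null" by (rule tensor_null.diff)
  then show "(x - y) - (x' - y') \<in> tensor_null" by (simp add: algebra_simps)
qed

lift_definition times_tensor_Q2 :: "'a tensor_Q2 \<Rightarrow> 'a tensor_Q2 \<Rightarrow> 'a tensor_Q2" is frag_mult
proof -
  fix x x' y y' :: "('a \<times> dyadic_rational) \<Rightarrow>\<^sub>0 int"
  assume "x - x' \<in> tensor_null" "y - y' \<in> tensor_null"
  then have "frag_mult (x - x') y + frag_mult x' (y - y') \<in> tensor_null"
    by (intro tensor_null_add frag_mult_null_left frag_mult_null_right)
  then show "frag_mult x y - frag_mult x' y' \<in> tensor_null"
    by (simp add: frag_mult_diff_left frag_mult_diff_right)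
qed

instance
  by standard
     (transfer; simp add: algebra_simps frag_mult_assoc frag_mult_add_left frag_mult_add_right
        frag_mult_one_left frag_mult_one_right tensor_null.zero)+

end

lift_definition tensor :: "'a :: dyadic_algebra \<Rightarrow> dyadic_rational \<Rightarrow> 'a tensor_Q2"  (infixl \<open>\<otimes>\<^sub>D\<close> 70)
  is "\<lambda>a q. frag_of (a, q)" .

lift_definition qscale :: "dyadic_rational \<Rightarrow> 'a :: dyadic_algebra tensor_Q2 \<Rightarrow> 'a tensor_Q2"
  (infixr \<open>*\<^sub>Q\<close> 75) is frag_scale
  by (metis frag_mult_diff_right frag_mult_null_right frag_scale_eq_mult)

lemma tensor_add_left: "(a + b) \<otimes>\<^sub>D q = a \<otimes>\<^sub>D q + b \<otimes>\<^sub>D q"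
  by transfer (metis diff_diff_add tensor_null.add_left)

lemma tensor_add_right: "a \<otimes>\<^sub>D (p + q) = a \<otimes>\<^sub>D p + a \<otimes>\<^sub>D q"
  by transfer (metis diff_diff_add tensor_null.add_right)

lemma tensor_dscale: "(r *\<^sub>D a) \<otimes>\<^sub>D q = a \<otimes>\<^sub>D (Fract r 1 * q)"
  by transfer (rule tensor_null.balanced)

lemma tensor_mult: "(a \<otimes>\<^sub>D p) * (b \<otimes>\<^sub>D q) = (a * b) \<otimes>\<^sub>D (p * q)"
  by transfer (simp add: frag_mult_of tensor_null.zero)

lemma tensor_one: "1 \<otimes>\<^sub>D 1 = 1"
  by transfer (simp add: tensor_null.zero)

lemma qscale_tensor: "r *\<^sub>Q (a \<otimes>\<^sub>D q) = a \<otimes>\<^sub>D (r * q)"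
  by transfer (simp add: frag_scale_def tensor_null.zero)

lemma qscale_eq_mult: "r *\<^sub>Q x = (1 \<otimes>\<^sub>D r) * x"
  by transfer (simp add: frag_scale_eq_mult tensor_null.zero)

lemma tensor_mult_commute_scalar: "(1 \<otimes>\<^sub>D r) * x = x * (1 \<otimes>\<^sub>D r)"
proof transfer
  fix r and x :: "('a \<times> dyadic_rational) \<Rightarrow>\<^sub>0 int"
  have "frag_mult (frag_of (1, r)) x = frag_mult x (frag_of (1, r))"
  proof (induction x rule: frag_induct)
    case (one a)
    then show ?case by (cases a) (simp add: frag_mult_of mult.commute)
  qed (auto simp: frag_mult_0_left frag_mult_0_right frag_mult_diff_left frag_mult_diff_right)
  then show "frag_mult (frag_of (1, r)) x - frag_mult x (frag_of (1, r)) \<in> tensor_null"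
    by (simp add: tensor_null.zero)
qed

lemma qscale_add_right: "r *\<^sub>Q (x + y) = r *\<^sub>Q x + r *\<^sub>Q y"
  and qscale_add_left: "(r + s) *\<^sub>Q x = r *\<^sub>Q x + s *\<^sub>Q x"
  and qscale_qscale: "r *\<^sub>Q s *\<^sub>Q x = (r * s) *\<^sub>Q x"
  and qscale_one: "1 *\<^sub>Q x = x"
  and qscale_mult_left: "(r *\<^sub>Q x) * y = r *\<^sub>Q (x * y)"
  by (simp_all add: qscale_eq_mult tensor_add_right tensor_one tensor_mult distrib_left distrib_right
        flip: mult.assoc)

lemma qscale_mult_right: "x * (r *\<^sub>Q y) = r *\<^sub>Q (x * y)"
  by (metis qscale_eq_mult tensor_mult_commute_scalar mult.assoc)

lemma tensor_Q2_induct [case_names zero tensor diff]: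
  assumes "P 0" "\<And>a q. P (a \<otimes>\<^sub>D q)" "\<And>x y. P x \<Longrightarrow> P y \<Longrightarrow> P (x - y)"
  shows "P x"
  using assms
proof (transfer, goal_cases)
  case (1 P x)
  show ?case
    by (induction x rule: frag_induct) (use 1 in auto)
qed

end

theory Submission
  imports Defs "HOL-Computational_Algebra.Formal_Power_Series"
begin

text \<open>
  Let $P_n = \sum_i \xi_i^{n+1}\,\partial/\partial\xi_i$. Differentiating the substitution
  $Jq_t\colon \xi_i \mapsto \xi_i + t\xi_i^2$ in $t$ gives
  $\frac{d}{dt} Jq_t = \sum_j (-2t)^j P_{j+1} \circ Jq_t$, because
  $\xi^2 = \frac{\xi^2}{1+2t\xi}\cdot\frac{\partial}{\partial\xi}(\xi + t\xi^2)$. The coefficient of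
  $t^k$ is the recurrence $(k+1) Jq^{k+1} = \sum_{j\le k} (-2)^j P_{j+1} Jq^{k-j}$, whose first two cases
  read $Jq^1 = P_1$ and $2P_2 = (Jq^1)^2 - 2Jq^2$. Since $[P_1, P_n] = (n-1)P_{n+1}$, all $P_n$ and hence
  all $Jq^k$ become polynomials in $Jq^1$ and $Jq^2$ after multiplication by a nonzero integer.
\<close>

unbundle fps_syntax

abbreviation (input) lookup where "lookup \<equiv> Poly_Mapping.lookup"

section \<open>Saturation\<close>

lemma Rep_dyadic_of_nat: "Rep_dyadic (of_nat n) k = int n mod 2 ^ k"
proof (induction n)
  case 0
  then show ?case by (simp add: zero_dyadic.rep_eq)
next
  case (Suc n)
  then show ?case
    by (simp add: plus_dyadic.rep_eq one_dyadic.rep_eq mod_add_eq del: one_mod_2_pow_eq)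
qed

text \<open>Since \<open>n < 2 ^ n\<close>, the residue of \<open>n\<close> modulo
  \<open>2 ^ n\<close> is \<open>n\<close> itself. This lets integer factors be divided out of the
  recurrences below.\<close>

lemma of_nat_dyadic_nonzero:
  assumes "n > 0"
  shows "(of_nat n :: dyadic) \<noteq> 0"
proof
  assume "(of_nat n :: dyadic) = 0"
  then have "int n mod 2 ^ n = 0"
    by (metis Rep_dyadic_of_nat zero_dyadic.rep_eq)
  moreover have "int n < 2 ^ n"
    by (metis less_exp of_nat_less_numeral_power_cancel_iff)
  ultimately show False using assms by simp
qed

text \<open>Denominators are cleared here, before tensoring: over the fraction field, an element of
  the saturation becomes a scalar multiple of an element of \<open>S\<close>.\<close>

definition saturation :: "'a :: dyadic_algebra set \<Rightarrow> 'a set" where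
  "saturation S = {a. \<exists>c. c \<noteq> 0 \<and> c *\<^sub>D a \<in> S}"

context
  fixes S :: "'a :: dyadic_algebra set"
begin

abbreviation (input) "sat \<equiv> saturation (subalgebra_generated (*\<^sub>D) S)"

lemma saturation_subalgebra: "a \<in> subalgebra_generated (*\<^sub>D) S \<Longrightarrow> a \<in> sat"
  unfolding saturation_def by (auto intro!: exI[of _ 1] simp: dscale_one)

lemma saturation_add:
  assumes "a \<in> sat" "b \<in> sat"
  shows "a + b \<in> sat"
proof -
  obtain c d where cd: "c \<noteq> 0" "d \<noteq> 0" "c *\<^sub>D a \<in> subalgebra_generated (*\<^sub>D) S"
      "d *\<^sub>D b \<in> subalgebra_generated (*\<^sub>D) S"
    using assms by (auto simp: saturation_def)
  have "(c * d) *\<^sub>D (a + b) = d *\<^sub>D c *\<^sub>D a + c *\<^sub>D d *\<^sub>D b"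
    by (simp add: dscale_add_right dscale_dscale mult.commute)
  also have "\<dots> \<in> subalgebra_generated (*\<^sub>D) S"
    by (intro subalgebra_generated.add subalgebra_generated.scale cd)
  finally show ?thesis
    using cd(1,2) by (auto simp: saturation_def intro!: exI[of _ "c * d"])
qed

lemma saturation_mult:
  assumes "a \<in> sat" "b \<in> sat"
  shows "a * b \<in> sat"
proof -
  obtain c d where cd: "c \<noteq> 0" "d \<noteq> 0" "c *\<^sub>D a \<in> subalgebra_generated (*\<^sub>D) S"
      "d *\<^sub>D b \<in> subalgebra_generated (*\<^sub>D) S"
    using assms by (auto simp: saturation_def)
  have "(c * d) *\<^sub>D (a * b) = (c *\<^sub>D a) * (d *\<^sub>D b)"
    by (simp add: dscale_mult_left dscale_mult_right dscale_dscale mult.commute)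
  then show ?thesis
    using cd by (auto simp: saturation_def intro!: exI[of _ "c * d"] intro: subalgebra_generated.mult)
qed

lemma saturation_scale:
  assumes "a \<in> sat"
  shows "r *\<^sub>D a \<in> sat"
proof -
  obtain c where c: "c \<noteq> 0" "c *\<^sub>D a \<in> subalgebra_generated (*\<^sub>D) S"
    using assms by (auto simp: saturation_def)
  have "c *\<^sub>D r *\<^sub>D a = r *\<^sub>D c *\<^sub>D a"
    by (simp add: dscale_dscale mult.commute)
  then show ?thesis
    using c by (auto simp: saturation_def intro!: exI[of _ c] intro: subalgebra_generated.scale)
qed

text \<open>The dyadic integers form a domain, so a nonzero factor in front of a recurrence can be
  absorbed into the denominator.\<close>

lemma saturation_cancel: "r *\<^sub>D a \<in> sat \<Longrightarrow> r \<noteq> 0 \<Longrightarrow> a \<in> sat"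
  by (auto simp: saturation_def dscale_dscale) (metis mult_eq_0_iff)

lemma saturation_diff:
  assumes "a \<in> sat" "b \<in> sat"
  shows "a - b \<in> sat"
  using saturation_add[OF assms(1) saturation_scale[OF assms(2), of "- 1"]]
  by (simp add: dscale_minus_one)

lemma saturation_sum: "(\<And>i. i \<in> I \<Longrightarrow> f i \<in> sat) \<Longrightarrow> sum f I \<in> sat"
  by (induction I rule: infinite_finite_induct)
     (auto intro: saturation_add saturation_subalgebra subalgebra_generated_zero)

end

text \<open>The saturation of a subalgebra is again a subalgebra, so it suffices to place generators
  in it.\<close>

lemma saturation_contains_subalgebra:
  assumes "T \<subseteq> saturation (subalgebra_generated (*\<^sub>D) S)" "a \<in> subalgebra_generated (*\<^sub>D) T"
  shows "a \<in> saturation (subalgebra_generated (*\<^sub>D) S)"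
  using assms(2)
  by induction (use assms(1) in \<open>auto intro: saturation_add saturation_mult saturation_scale
      saturation_subalgebra subalgebra_generated.one\<close>)

section \<open>Generating polynomials\<close>

lemma single_eq_xi_power: "Poly_Mapping.single (Poly_Mapping.single i n) 1 = xi i ^ n"
proof (induction n)
  case (Suc n)
  have "Poly_Mapping.single (Poly_Mapping.single i (Suc n)) 1 =
      (Poly_Mapping.single (Poly_Mapping.single i 1) 1 * Poly_Mapping.single (Poly_Mapping.single i n) 1 :: dpoly)"
    by (simp add: mult_single flip: single_add)
  then show ?case by (simp add: Suc xi_def)
qed simp

lemma dpoly_induct [case_names single add]:
  assumes "\<And>m c. P (Poly_Mapping.single m c)"
    and "\<And>p q. P p \<Longrightarrow> P q \<Longrightarrow> P (p + q)"
  shows "P (p :: dpoly)"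
proof -
  have "P (\<Sum>m\<in>A. Poly_Mapping.single m (lookup p m))" if "finite A" for A
    using that assms(1)[of 0 0] by (induction A rule: finite_induct) (auto intro: assms)
  then show ?thesis by (subst poly_decompose) simp
qed

text \<open>Reduces identities between homomorphisms or derivations to constants and
  variables.\<close>

lemma dpoly_generator_induct [case_names const xi add mult]:
  assumes const: "\<And>c. P (const c)" and xi: "\<And>i. P (xi i)"
    and add: "\<And>p q. P p \<Longrightarrow> P q \<Longrightarrow> P (p + q)"
    and mult: "\<And>p q. P p \<Longrightarrow> P q \<Longrightarrow> P (p * q)"
  shows "P (p :: dpoly)"
proof (induction p rule: dpoly_induct)
  case (single m c)
  have pow: "P (xi i ^ n)" for i n
    by (induction n) (auto intro: mult xi simp: const[of 1, unfolded const_1])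
  \<comment> \<open>The exponent vector is built one variable at a time, each new variable
    contributing a factor \<open>xi i ^ n\<close>.\<close>
  have "P (Poly_Mapping.single m 1)"
  proof (induction m rule: update_induct)
    case const
    then show ?case using assms(1)[of 1] by (simp add: const_def)
  next
    case (update m i n)
    have "Poly_Mapping.update i n m = m + Poly_Mapping.single i n"
      using update(1)
      by (intro poly_mapping_eqI) (auto simp: lookup_update lookup_add lookup_single in_keys_iff when_def)
    then have "Poly_Mapping.single (Poly_Mapping.update i n m) (1 :: dyadic) = Poly_Mapping.single m 1 * xi i ^ n"
      by (simp add: mult_single flip: single_eq_xi_power)
    then show ?case using update pow mult by simp
  qed
  then have "P (const c * Poly_Mapping.single m 1)" using const mult by blast
  then show ?case by (simp add: const_def mult_single)
qed (rule add)

section \<open>The generating series of the operations\<close>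

text \<open>The series Jq_t(p) in the parameter t = \<open>fps_X\<close>; its multiplicativity packs
  the Cartan formulas for all Jq^k into one equation.\<close>

definition Jq_fps :: "dpoly \<Rightarrow> dpoly fps" where
  "Jq_fps p = Abs_fps (\<lambda>k. Jq_op k p)"

text \<open>This is p with every xi_i replaced by t xi_i, hence a ring homomorphism recording degree
  as the exponent of t.\<close>

definition homogeneous_fps :: "dpoly \<Rightarrow> dpoly fps" where
  "homogeneous_fps p = Abs_fps (\<lambda>d. homogeneous_part d p)"

lemma mdeg_superset: "finite A \<Longrightarrow> Poly_Mapping.keys m \<subseteq> A \<Longrightarrow> mdeg m = (\<Sum>i\<in>A. lookup m i)"
  unfolding mdeg_def by (intro sum.mono_neutral_left) (auto simp: in_keys_iff)

lemma mdeg_add: "mdeg (m + n) = mdeg m + mdeg n"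
  using keys_add[of m n]
  by (simp add: mdeg_superset[of "Poly_Mapping.keys m \<union> Poly_Mapping.keys n"] lookup_add sum.distrib)

lemma homogeneous_part_single:
  "homogeneous_part d (Poly_Mapping.single m c) = (if mdeg m = d then Poly_Mapping.single m c else 0)"
  by (intro poly_mapping_eqI) (auto simp: lookup_homogeneous_part lookup_single when_def)

lemma homogeneous_fps_single:
  "homogeneous_fps (Poly_Mapping.single m c) = fps_const (Poly_Mapping.single m c) * fps_X ^ mdeg m"
  by (auto simp: fps_eq_iff homogeneous_fps_def homogeneous_part_single fps_X_power_mult_right_nth)

lemma homogeneous_fps_add: "homogeneous_fps (p + q) = homogeneous_fps p + homogeneous_fps q"
  by (simp add: fps_eq_iff homogeneous_fps_def homogeneous_part_add)

lemma homogeneous_fps_mult: "homogeneous_fps (p * q) = homogeneous_fps p * homogeneous_fps q"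
proof (induction p rule: dpoly_induct)
  case (single m c)
  show ?case
  proof (induction q rule: dpoly_induct)
    case (single n d)
    then show ?case
      by (simp only: mult_single homogeneous_fps_single mdeg_add power_add flip: fps_const_mult)
         (simp only: mult_ac flip: fps_const_mult mult_single)
  qed (simp add: distrib_left homogeneous_fps_add)
qed (simp add: distrib_right homogeneous_fps_add)

lemma homogeneous_fps_one: "homogeneous_fps 1 = 1"
  using homogeneous_fps_single[of 0 1] by (simp add: mdeg_def)

lemma homogeneous_fps_power: "homogeneous_fps (p ^ n) = homogeneous_fps p ^ n"
  by (induction n) (simp_all add: homogeneous_fps_one homogeneous_fps_mult)

lemma homogeneous_fps_prod: "homogeneous_fps (prod f A) = (\<Prod>a\<in>A. homogeneous_fps (f a))"
  by (induction A rule: infinite_finite_induct) (simp_all add: homogeneous_fps_one homogeneous_fps_mult)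

lemma homogeneous_fps_xi: "homogeneous_fps (xi i) = fps_const (xi i) * fps_X"
  by (simp add: xi_def homogeneous_fps_single mdeg_def)

text \<open>Image of the monomial with exponents \<open>m\<close> under the substitution of xi_i + t
  xi_i^2 for xi_i.\<close>

definition Jq_fps_monomial :: "(nat \<Rightarrow>\<^sub>0 nat) \<Rightarrow> dpoly fps" where
  "Jq_fps_monomial m =
    (\<Prod>i\<in>Poly_Mapping.keys m. (fps_const (xi i) + fps_X * fps_const (xi i ^ 2)) ^ lookup m i)"

lemma Jq_fps_monomial_add: "Jq_fps_monomial (m + n) = Jq_fps_monomial m * Jq_fps_monomial n"
proof -
  let ?A = "Poly_Mapping.keys m \<union> Poly_Mapping.keys n"
  have *: "Jq_fps_monomial k = (\<Prod>i\<in>?A. (fps_const (xi i) + fps_X * fps_const (xi i ^ 2)) ^ lookup k i)"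
    if "Poly_Mapping.keys k \<subseteq> ?A" for k
    unfolding Jq_fps_monomial_def using that
    by (intro prod.mono_neutral_left) (auto simp: in_keys_iff)
  show ?thesis
    using keys_add[of m n] by (simp add: * lookup_add power_add prod.distrib)
qed

text \<open>Replacing xi by t xi in xi + xi^2 gives t (xi + t xi^2); the extracted factors t
  multiply to \<open>fps_X ^ mdeg m\<close>.\<close>

lemma homogeneous_fps_Jq_monomial:
  "homogeneous_fps (Jq_monomial m) = fps_X ^ mdeg m * Jq_fps_monomial m"
proof -
  have "homogeneous_fps (xi i + xi i ^ 2) = fps_X * (fps_const (xi i) + fps_X * fps_const (xi i ^ 2))" for i
    by (simp add: homogeneous_fps_add homogeneous_fps_power homogeneous_fps_xi power_mult_distrib algebra_simps
        power2_eq_square[of fps_X])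
  then show ?thesis
    by (simp add: Jq_monomial_def Jq_fps_monomial_def mdeg_def homogeneous_fps_prod homogeneous_fps_power
        power_mult_distrib prod.distrib power_sum)
qed

lemma Jq_fps_single: "Jq_fps (Poly_Mapping.single m c) = fps_const (const c) * Jq_fps_monomial m"
proof (rule fps_ext)
  fix k
  have "homogeneous_part (mdeg m + k) (Jq_monomial m) = Jq_fps_monomial m $ k"
    using arg_cong[OF homogeneous_fps_Jq_monomial[of m], of "\<lambda>F. F $ (mdeg m + k)"]
    by (simp add: homogeneous_fps_def fps_X_power_mult_nth)
  then have "homogeneous_part (mdeg m + k) (Jq_total (homogeneous_part (mdeg m) (Poly_Mapping.single m c))) =
      const c * Jq_fps_monomial m $ k"
    by (simp add: homogeneous_part_single Jq_total_single homogeneous_part_const_mult)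
  then show "Jq_fps (Poly_Mapping.single m c) $ k = (fps_const (const c) * Jq_fps_monomial m) $ k"
    \<comment> \<open>A monomial contributes in one degree only; the superset
      \<open>{mdeg m}\<close> also covers \<open>c = 0\<close>, where there are no keys.\<close>
    using Jq_op_superset[of "{mdeg m}" "Poly_Mapping.single m c" k]
    by (simp add: Jq_fps_def)
qed

lemma Jq_fps_add: "Jq_fps (p + q) = Jq_fps p + Jq_fps q"
  by (simp add: fps_eq_iff Jq_fps_def Jq_op_add)

lemma Jq_fps_mult: "Jq_fps (p * q) = Jq_fps p * Jq_fps q"
proof (induction p rule: dpoly_induct)
  case (single m c)
  show ?case
  proof (induction q rule: dpoly_induct)
    case (single n d)
    then show ?case
      by (simp add: mult_single Jq_fps_single Jq_fps_monomial_add const_mult mult_ac flip: fps_const_mult)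
  qed (simp add: distrib_left Jq_fps_add)
qed (simp add: distrib_right Jq_fps_add)

lemma Jq_fps_const: "Jq_fps (const c) = fps_const (const c)"
  by (subst const_def) (simp add: Jq_fps_single Jq_fps_monomial_def)

lemma Jq_fps_xi: "Jq_fps (xi i) = fps_const (xi i) + fps_X * fps_const (xi i ^ 2)"
  by (subst xi_def) (simp add: Jq_fps_single Jq_fps_monomial_def const_1)

text \<open>Taking the constant coefficient of \<open>Jq_fps\<close> is a ring homomorphism fixing
  constants and variables.\<close>

lemma Jq_op_0: "Jq_op 0 p = p"
proof -
  have "Jq_fps p $ 0 = p"
    by (induction p rule: dpoly_generator_induct)
       (simp_all add: Jq_fps_const Jq_fps_xi Jq_fps_add Jq_fps_mult)
  then show ?thesis by (simp add: Jq_fps_def)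
qed

section \<open>The derivations\<close>

text \<open>The factor by which P_n multiplies a monomial: xi^a goes to a xi^(a+n), so no exponent
  has to be lowered.\<close>

definition vfield_weight :: "nat \<Rightarrow> (nat \<Rightarrow>\<^sub>0 nat) \<Rightarrow> dpoly" where
  "vfield_weight n m = (\<Sum>i\<in>Poly_Mapping.keys m. of_nat (lookup m i) * xi i ^ n)"

text \<open>The derivation $P_n = \sum_i \xi_i^{n+1}\,\partial/\partial\xi_i$.\<close>

definition vfield :: "nat \<Rightarrow> dpoly \<Rightarrow> dpoly" where
  "vfield n p = (\<Sum>m\<in>Poly_Mapping.keys p. Poly_Mapping.single m (lookup p m) * vfield_weight n m)"

lemma vfield_weight_add: "vfield_weight n (l + m) = vfield_weight n l + vfield_weight n m"
proof -
  let ?A = "Poly_Mapping.keys l \<union> Poly_Mapping.keys m"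
  have *: "vfield_weight n k = (\<Sum>i\<in>?A. of_nat (lookup k i) * xi i ^ n)"
    if "Poly_Mapping.keys k \<subseteq> ?A" for k
    unfolding vfield_weight_def using that
    by (intro sum.mono_neutral_left) (auto simp: in_keys_iff)
  show ?thesis
    using keys_add[of l m] by (simp add: * lookup_add distrib_right sum.distrib)
qed

lemma vfield_single: "vfield n (Poly_Mapping.single m c) = Poly_Mapping.single m c * vfield_weight n m"
  by (simp add: vfield_def)

lemma vfield_add: "vfield n (p + q) = vfield n p + vfield n q"
  unfolding vfield_def
  by (rule setsum_keys_plus_distrib) (simp_all add: single_add distrib_right)

text \<open>On monomials the Leibniz rule is the additivity of the weights.\<close>

lemma vfield_mult: "vfield n (p * q) = vfield n p * q + p * vfield n q"
proof (induction p rule: dpoly_induct)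
  case (single l c)
  show ?case
  proof (induction q rule: dpoly_induct)
    case (single m d)
    then show ?case
      by (simp add: mult_single[symmetric] vfield_single)
         (simp add: mult_single vfield_single vfield_weight_add algebra_simps flip: mult.assoc)
  qed (simp add: algebra_simps vfield_add)
qed (simp add: algebra_simps vfield_add)

lemma vfield_const: "vfield n (const c) = 0"
  by (simp add: const_def vfield_single vfield_weight_def)

lemma vfield_const_mult: "vfield n (const c * p) = const c * vfield n p"
  by (simp add: vfield_mult vfield_const)

lemma vfield_xi: "vfield n (xi i) = xi i ^ Suc n"
  by (simp add: xi_def vfield_single vfield_weight_def)

lemma vfield_0: "vfield n 0 = 0"
  by (simp add: vfield_def)

lemma vfield_sum: "vfield n (sum f A) = (\<Sum>a\<in>A. vfield n (f a))"
  by (induction A rule: infinite_finite_induct) (simp_all add: vfield_0 vfield_add)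

lemma vfield_xi_power: "vfield n (xi i ^ k) = of_nat k * xi i ^ (n + k)"
  by (induction k) (simp_all add: vfield_const[of n 1, unfolded const_1] vfield_mult vfield_xi algebra_simps power_add)

lemma poly_ring_vfield:
  assumes "p \<in> poly_ring k"
  shows "vfield n p \<in> poly_ring k"
  unfolding vfield_def vfield_weight_def
proof (intro poly_ring_sum poly_ring_mult poly_ring_power poly_ring_xi)
  fix m i assume "m \<in> Poly_Mapping.keys p"
  then have m: "Poly_Mapping.keys m \<subseteq> {1..k}" using assms by (simp add: poly_ring_def)
  then show "Poly_Mapping.single m (lookup p m) \<in> poly_ring k" by (simp add: poly_ring_def)
  show "of_nat j \<in> poly_ring k" for j
    by (induction j) (auto intro: poly_ring_add poly_ring_0 poly_ring_1)
  assume "i \<in> Poly_Mapping.keys m"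
  then show "i \<in> {1..k}" using m by blast
qed

text \<open>This is [P_1, P_n] = (n - 1) P_(n+1) with one P_(n+1) moved to the left, which keeps the
  coefficient a natural number. A commutator of derivations is a derivation, so variables suffice;
  there (n + 1) - 2 + 1 = n.\<close>

lemma vfield_commutator:
  "vfield 1 (vfield n p) - vfield n (vfield 1 p) + vfield (Suc n) p = of_nat n * vfield (Suc n) p"
proof (induction p rule: dpoly_generator_induct)
  case (xi i)
  have "vfield 1 (vfield n (xi i)) = of_nat (Suc n) * xi i ^ (n + 2)"
    and "vfield n (vfield 1 (xi i)) = 2 * xi i ^ (n + 2)"
    using vfield_xi_power[of 1 i "Suc n"] vfield_xi_power[of n i "Suc 1"]
    by (simp_all add: vfield_xi del: power_Suc)
  then show ?case
    by (simp add: vfield_xi algebra_simps)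
next
  case (mult p q)
  \<comment> \<open>The mixed products of P_1 and P_n on different factors occur in both orders of
    composition and cancel.\<close>
  have "vfield 1 (vfield n (p * q)) - vfield n (vfield 1 (p * q)) + vfield (Suc n) (p * q) =
     (vfield 1 (vfield n p) - vfield n (vfield 1 p) + vfield (Suc n) p) * q +
      p * (vfield 1 (vfield n q) - vfield n (vfield 1 q) + vfield (Suc n) q)"
    by (simp add: vfield_mult vfield_add algebra_simps)
  then show ?case by (simp only: mult) (simp add: vfield_mult algebra_simps)
qed (simp_all add: vfield_const vfield_0 vfield_add algebra_simps)

section \<open>The recurrence\<close>

text \<open>The extension of P_n for which the parameter t is a constant.\<close>

definition vfield_fps :: "nat \<Rightarrow> dpoly fps \<Rightarrow> dpoly fps" where
  "vfield_fps n F = Abs_fps (\<lambda>k. vfield n (F $ k))"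

lemma vfield_fps_add: "vfield_fps n (F + G) = vfield_fps n F + vfield_fps n G"
  by (simp add: fps_eq_iff vfield_fps_def vfield_add)

lemma vfield_fps_mult: "vfield_fps n (F * G) = vfield_fps n F * G + F * vfield_fps n G"
  by (simp add: fps_eq_iff vfield_fps_def fps_mult_nth vfield_sum vfield_mult sum.distrib)

lemma vfield_fps_const: "vfield_fps n (fps_const c) = fps_const (vfield n c)"
  by (simp add: fps_eq_iff vfield_fps_def vfield_0)

lemma vfield_fps_X: "vfield_fps n fps_X = 0"
  by (simp add: fps_eq_iff vfield_fps_def vfield_0 fps_X_def vfield_const[of n 1, unfolded const_1])

text \<open>
  Both terms of \<open>defect n\<close> are derivations along the homomorphism \<^const>\<open>Jq_fps\<close>, so it suffices to
  evaluate them on the variables. Truncating the sum at \<open>n\<close> keeps it finite and only affects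
  the coefficients beyond \<open>n\<close>.
\<close>

definition defect :: "nat \<Rightarrow> dpoly \<Rightarrow> dpoly fps" where
  "defect n p = fps_deriv (Jq_fps p) - (\<Sum>j\<le>n. (- 2) ^ j * fps_X ^ j * vfield_fps (Suc j) (Jq_fps p))"

lemma defect_add: "defect n (p + q) = defect n p + defect n q"
  by (simp add: defect_def Jq_fps_add vfield_fps_add distrib_left sum.distrib)

lemma defect_mult: "defect n (p * q) = defect n p * Jq_fps q + Jq_fps p * defect n q"
  by (simp add: defect_def Jq_fps_mult vfield_fps_mult distrib_left sum.distrib algebra_simps
      sum_distrib_left sum_distrib_right)

lemma defect_const: "defect n (const c) = 0"
  by (simp add: defect_def Jq_fps_const vfield_fps_const vfield_const)

text \<open>The sum telescopes: P_(j+1) sends xi + t xi^2 to xi^(j+2) + 2t xi^(j+3), and after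
  weighting by (-2t)^j the second term cancels the first term of the next summand. The initial xi^2
  cancels the derivative, so only the tail of the last summand survives.\<close>

lemma defect_xi: "defect n (xi i) = (- 2) ^ Suc n * fps_X ^ Suc n * fps_const (xi i ^ (n + 3))"
proof -
  have *: "vfield_fps (Suc j) (Jq_fps (xi i)) =
      fps_const (xi i ^ (j + 2)) + 2 * fps_X * fps_const (xi i ^ (j + 3))" for j
  proof -
    have "vfield (Suc j) ((xi i)\<^sup>2) = 2 * xi i ^ (j + 3)"
      by (simp only: vfield_xi_power) (simp add: eval_nat_numeral)
    then show ?thesis
      by (simp add: Jq_fps_xi vfield_fps_add vfield_fps_mult vfield_fps_const vfield_fps_X vfield_xi
          numeral_fps_const mult_ac flip: fps_const_mult)
  qed
  show ?thesis
  proof (induction n)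
    case 0
    show ?case
      unfolding defect_def * by (simp add: Jq_fps_xi power2_eq_square)
  next
    case (Suc n)
    have "defect (Suc n) (xi i) =
        defect n (xi i) - (- 2) ^ Suc n * fps_X ^ Suc n * vfield_fps (Suc (Suc n)) (Jq_fps (xi i))"
      by (simp add: defect_def)
    then show ?case unfolding Suc * by (simp add: algebra_simps numeral_3_eq_3)
  qed
qed

text \<open>On a variable the defect is divisible by t^(n+1). For a product, every term of the
  convolution contains a defect coefficient of index at most \<open>k\<close>.\<close>

lemma defect_nth: "k \<le> n \<Longrightarrow> defect n p $ k = 0"
proof (induction p arbitrary: k rule: dpoly_generator_induct)
  case (xi i)
  have "defect n (xi i) = fps_X ^ Suc n * ((- 2) ^ Suc n * fps_const (xi i ^ (n + 3)))"
    by (simp add: defect_xi mult_ac)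
  then show ?case using xi by (simp add: fps_X_power_mult_nth del: power_Suc)
next
  case (mult p q)
  then show ?case
    by (simp add: defect_mult fps_mult_nth)
qed (simp_all add: defect_const defect_add)

lemma Jq_op_recurrence:
  "of_nat (Suc k) * Jq_op (Suc k) p = (\<Sum>j\<le>k. (- 2) ^ j * vfield (Suc j) (Jq_op (k - j) p))"
proof -
  have "((- 2) ^ j * fps_X ^ j * F) $ k = (- 2) ^ j * F $ (k - j)" if "j \<le> k" for j and F :: "dpoly fps"
  proof -
    have "(- 2) ^ j = (fps_const ((- 2) ^ j) :: dpoly fps)"
      by (simp add: numeral_fps_const flip: fps_const_power)
    then have eq: "(- 2) ^ j * fps_X ^ j * F = fps_X ^ j * (fps_const ((- 2) ^ j) * F)"
      by (simp only: mult_ac)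
    show ?thesis unfolding eq using that by (simp add: fps_X_power_mult_nth)
  qed
  \<comment> \<open>Truncation at \<open>k\<close> suffices for the coefficient of t^k; the
    derivative supplies the factor k + 1.\<close>
  then show ?thesis
    using defect_nth[of k k p]
    by (simp add: defect_def fps_sum_nth vfield_fps_def Jq_fps_def)
qed

section \<open>The subalgebra generated by the first two operations\<close>

text \<open>The P_k are treated inside \<open>poly_ops\<close>, since in general only multiples of
  them are shown to lie in the algebra of the Jq^k.\<close>

lift_definition vfield_ops :: "nat \<Rightarrow> poly_ops" is
  "\<lambda>k n p. if p \<in> poly_ring n then vfield k p else 0"
  by (auto simp: poly_ring_vfield poly_ring_add poly_ring_mult poly_ring_const
        vfield_add vfield_const_mult)

lemma apply_op_sum: "apply_op (sum f A) n p = (\<Sum>a\<in>A. apply_op (f a) n p)"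
  by (induction A rule: infinite_finite_induct) (simp_all add: apply_op_simps)

lemma const_of_nat: "const (of_nat k) = of_nat k"
  by (induction k) (simp_all add: const_0 const_1 const_add)

lemma const_uminus: "const (- c) = - const c"
  by (simp add: const_def single_uminus)

lemma const_numeral: "const (numeral k) = numeral k"
  using const_of_nat[of "numeral k"] by simp

lemma const_power: "const (c ^ k) = const c ^ k"
  by (induction k) (simp_all add: const_1 const_mult)

lemma vfield_ops_commutator:
  "of_nat n *\<^sub>D vfield_ops (Suc n) =
    vfield_ops 1 * vfield_ops n - vfield_ops n * vfield_ops 1 + vfield_ops (Suc n)"
  by (rule poly_ops_eqI)
     (simp add: apply_op_simps vfield_ops.rep_eq poly_ring_vfield const_of_nat flip: vfield_commutator)

lemma Jq_ops_0: "Jq_ops 0 = 1"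
  by (rule poly_ops_eqI) (simp add: apply_op_simps Jq_ops.rep_eq Jq_op_0)

lemma Jq_ops_recurrence:
  "of_nat (Suc k) *\<^sub>D Jq_ops (Suc k) = (\<Sum>j\<le>k. (- 2) ^ j *\<^sub>D (vfield_ops (Suc j) * Jq_ops (k - j)))"
  by (rule poly_ops_eqI)
     (simp add: apply_op_simps apply_op_sum vfield_ops.rep_eq Jq_ops.rep_eq poly_ring_Jq_op
        const_of_nat const_power const_uminus const_numeral Jq_op_recurrence del: of_nat_Suc)

lemma vfield_ops_1: "vfield_ops 1 = Jq_ops 1"
  using Jq_ops_recurrence[of 0] by (simp add: dscale_one Jq_ops_0)

text \<open>The second case of the recurrence, solved for P_2.\<close>

lemma two_vfield_ops_2: "2 *\<^sub>D vfield_ops 2 = Jq_ops 1 * Jq_ops 1 - 2 *\<^sub>D Jq_ops 2"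
proof -
  have "2 *\<^sub>D Jq_ops 2 = Jq_ops 1 * Jq_ops 1 + (- 2) *\<^sub>D vfield_ops 2"
    using Jq_ops_recurrence[of 1]
    by (simp add: dscale_one Jq_ops_0 vfield_ops_1[unfolded One_nat_def] numeral_2_eq_2)
  moreover have "2 *\<^sub>D vfield_ops 2 = - ((- 2) *\<^sub>D vfield_ops 2)"
    by (simp add: eq_neg_iff_add_eq_0 dscale_zero_left flip: dscale_add_left)
  ultimately show ?thesis by (simp add: algebra_simps)
qed

abbreviation (input) "Jq12_saturation \<equiv> saturation (subalgebra_generated (*\<^sub>D) {Jq_ops 1, Jq_ops 2})"

lemma Jq_ops_12: "Jq_ops 1 \<in> Jq12_saturation" "Jq_ops 2 \<in> Jq12_saturation"
  by (auto intro: saturation_subalgebra subalgebra_generated.generator)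

text \<open>P_2 needs its own base case because [P_1, P_1] = 0 says nothing about it. From P_3 on,
  the commutator with P_1 yields a nonzero multiple of the next derivation.\<close>

lemma vfield_ops_in_saturation: "vfield_ops (Suc n) \<in> Jq12_saturation"
proof (induction n rule: less_induct)
  case (less n)
  consider "n = 0" | "n = 1" | l where "n = Suc (Suc l)"
    by (metis One_nat_def not0_implies_Suc)
  then show ?case
  proof cases
    case 1
    then show ?thesis using Jq_ops_12(1) vfield_ops_1 by simp
  next
    case 2
    have "2 *\<^sub>D vfield_ops 2 \<in> Jq12_saturation"
      unfolding two_vfield_ops_2
      by (intro saturation_diff saturation_mult saturation_scale Jq_ops_12)
    then show ?thesis
      using 2 saturation_cancel[of 2] of_nat_dyadic_nonzero[of 2] by (simp add: numeral_2_eq_2)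
  next
    case 3
    \<comment> \<open>Here \<open>Suc l\<close> is n - 1, the positive factor to be
      cancelled.\<close>
    have "of_nat (Suc l) *\<^sub>D vfield_ops (Suc n) = of_nat n *\<^sub>D vfield_ops (Suc n) - vfield_ops (Suc n)"
      using dscale_add_left[of 1 "of_nat (Suc l)" "vfield_ops (Suc n)"] by (simp add: 3 dscale_one)
    also have "\<dots> = vfield_ops 1 * vfield_ops n - vfield_ops n * vfield_ops 1"
      by (simp add: vfield_ops_commutator)
    also have "\<dots> \<in> Jq12_saturation"
      using less[of 0] less[of "Suc l"] 3 by (auto intro!: saturation_diff saturation_mult)
    finally show ?thesis
      using saturation_cancel of_nat_dyadic_nonzero by blast
  qed
qed

lemma Jq_ops_in_saturation: "Jq_ops k \<in> Jq12_saturation"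
proof (induction k rule: less_induct)
  case (less k)
  show ?case
  proof (cases k)
    case 0
    then show ?thesis
      by (auto simp: Jq_ops_0 intro: saturation_subalgebra subalgebra_generated.one)
  next
    case (Suc l)
    have "of_nat (Suc l) *\<^sub>D Jq_ops (Suc l) \<in> Jq12_saturation"
      unfolding Jq_ops_recurrence
      by (intro saturation_sum saturation_scale saturation_mult vfield_ops_in_saturation)
         (use less Suc in simp)
    then show ?thesis
      using Suc saturation_cancel of_nat_dyadic_nonzero by blast
  qed
qed

section \<open>Descent to the dyadic Steenrod algebra and extension of scalars\<close>

lemma subalgebra_generated_steenrod:
  assumes "F \<in> subalgebra_generated (*\<^sub>D) {Jq_ops 1, Jq_ops 2}"
  shows "\<exists>a\<in>subalgebra_generated (*\<^sub>D) {Jq 1, Jq 2}. steenrod_ops a = F"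
  using assms
proof induction
  case (generator F)
  then show ?case
    by (metis Jq.rep_eq insert_iff singletonD subalgebra_generated.generator)
qed (metis subalgebra_generated.intros one_dyadic_steenrod.rep_eq plus_dyadic_steenrod.rep_eq
    times_dyadic_steenrod.rep_eq dscale_dyadic_steenrod.rep_eq)+

lemma steenrod_multiple:
  obtains c where "c \<noteq> 0" "c *\<^sub>D a \<in> subalgebra_generated (*\<^sub>D) {Jq 1, Jq 2}"
proof -
  have "steenrod_ops a \<in> Jq12_saturation"
    by (rule saturation_contains_subalgebra[OF _ steenrod_ops]) (use Jq_ops_in_saturation in blast)
  \<comment> \<open>By injectivity of \<open>steenrod_ops\<close>, the lift of the multiple found
    among the operators is the multiple of \<open>a\<close> itself.\<close>
  then show thesis
    using subalgebra_generated_steenrod that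
    by (auto simp: saturation_def simp flip: dscale_dyadic_steenrod.rep_eq) 
       (metis steenrod_ops_inject)
qed

text \<open>The map sending a to \<open>a \<otimes>\<^sub>D 1\<close> is a ring homomorphism turning
  a dyadic scalar r into the fraction r/1.\<close>

lemma subalgebra_generated_tensor:
  assumes "a \<in> subalgebra_generated (*\<^sub>D) S"
  shows "a \<otimes>\<^sub>D 1 \<in> subalgebra_generated (*\<^sub>Q) ((\<lambda>s. s \<otimes>\<^sub>D 1) ` S)"
  using assms
proof induction
  case (mult a b)
  then show ?case
    using subalgebra_generated.mult tensor_mult[of a 1 b 1] by fastforce
next
  case (scale a r)
  have "(r *\<^sub>D a) \<otimes>\<^sub>D 1 = Fraction_Field.Fract r 1 *\<^sub>Q (a \<otimes>\<^sub>D 1)"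
    by (simp add: tensor_dscale qscale_tensor)
  then show ?case using scale by (simp add: subalgebra_generated.scale)
qed (auto simp: tensor_add_left tensor_one intro: subalgebra_generated.intros)

theorem theorem3p7:
  "subalgebra_generated (*\<^sub>Q) {Jq 1 \<otimes>\<^sub>D 1, Jq 2 \<otimes>\<^sub>D 1} =
    (UNIV :: dyadic_steenrod tensor_Q2 set)"
proof -
  let ?Q = "subalgebra_generated (*\<^sub>Q) {Jq 1 \<otimes>\<^sub>D 1, Jq 2 \<otimes>\<^sub>D 1}"
  have tensor: "a \<otimes>\<^sub>D q \<in> ?Q" for a q
  proof -
    obtain c where c: "c \<noteq> 0" "c *\<^sub>D a \<in> subalgebra_generated (*\<^sub>D) {Jq 1, Jq 2}"
      by (rule steenrod_multiple)
    \<comment> \<open>The denominator \<open>c\<close> moves across the tensor sign and is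
      compensated by the scalar 1/c.\<close>
    have "Fraction_Field.Fract 1 c * Fraction_Field.Fract c 1 = 1"
      using c(1) by (simp add: One_fract_def eq_fract)
    then have "a \<otimes>\<^sub>D q = (q * Fraction_Field.Fract 1 c) *\<^sub>Q ((c *\<^sub>D a) \<otimes>\<^sub>D 1)"
      by (simp add: tensor_dscale qscale_tensor mult.assoc)
    then show ?thesis
      using subalgebra_generated_tensor[OF c(2)] by (simp add: subalgebra_generated.scale)
  qed
  have "x \<in> ?Q" for x
  proof (induction x rule: tensor_Q2_induct)
    case zero
    show ?case using tensor[of 0 0] tensor_add_left[of 0 0 0] by (metis add_cancel_right_right)
  next
    case (diff x y)
    \<comment> \<open>Closure under negation comes from the scalar -1.\<close>
    have "y + (- 1) *\<^sub>Q y = 0"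
      using qscale_add_left[of "- 1" 1 y] qscale_add_left[of 0 0 y]
      by (simp add: qscale_one algebra_simps)
    then have "x + - y \<in> ?Q"
      by (metis minus_unique diff subalgebra_generated.add subalgebra_generated.scale)
    then show ?case by simp
  qed (rule tensor)
  then show ?thesis by blast
qed

end
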